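(* Let $n\ge 2$ and let $K_n=[k_{ij}]$ be the $n\times n$ tridiagonal matrix with $k_{22}=3$, $k_{ii}=1$ for $i\ne 2$, $k_{i+1,i}=1$ and $k_{i,i+1}=2$ for $1\le i\le n-1$, and all other entries $0$. Define $K_n^{(0)}=K_n$ and, for $1\le r\le n-2$, let $K_n^{(r)}$ be the contraction of $K_n^{(r-1)}$ on column $1$ relative to rows $1$ and $2$. Then $$\operatorname{per}K_n=\operatorname{per}K_n^{(n-2)}=j_n,$$ where $j_m$ denotes the $m$th Jacobsthal-Lucas number.
   Context: The Jacobsthal-Lucas numbers are defined by $j_0=2$, $j_1=1$, $j_{m+2}=j_{m+1}+2j_m$ for $m\ge 0$. The permanent of an $n\times n$ matrix $A=[a_{ij}]$ is $\operatorname{per}A=\sum_{\sigma\in S_n}\prod_{i=1}^n a_{i\sigma(i)}$. Contraction: if column $k$ of a matrix $A$ (with rows $r_1,\dots,r_m$) contains exactly two nonzero entries $a_{ik}$ and $a_{jk}$ ($i\ne j$), the contraction of $A$ on column $k$ relative to rows $i$ and $j$ is the $(m-1)\times(n-1)$ matrix obtained from $A$ by replacing row $i$ with $a_{jk}r_i+a_{ik}r_j$ and deleting row $j$ and column $k$. ($K_n$ is the adjacency matrix of a certain directed pseudo graph.) *)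

theory Defs
  imports "Jordan_Normal_Form.Determinant"
begin

fun jacobsthal_lucas :: "nat \<Rightarrow> int" where
  "jacobsthal_lucas 0 = 2"
| "jacobsthal_lucas (Suc 0) = 1"
| "jacobsthal_lucas (Suc (Suc m)) = jacobsthal_lucas (Suc m) + 2 * jacobsthal_lucas m"

text \<open>As for \<^const>\<open>det\<close>, the value is 0 by convention on non-square matrices.\<close>

definition permanent :: "'a mat \<Rightarrow> 'a :: comm_semiring_1" where
  "permanent A = (if dim_row A = dim_col A
     then (\<Sum>p \<in> {p. p permutes {0..<dim_row A}}. \<Prod>i = 0..<dim_row A. A $$ (i, p i))
     else 0)"

text \<open>Rows and columns are indexed from 0 throughout.\<close>

definition contractible :: "'a :: zero mat \<Rightarrow> nat \<Rightarrow> nat \<Rightarrow> nat \<Rightarrow> bool" where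
  "contractible A k i j \<longleftrightarrow>
     k < dim_col A \<and> i \<noteq> j \<and> {p. p < dim_row A \<and> A $$ (p, k) \<noteq> 0} = {i, j}"

text \<open>
  Contraction on column \<open>k\<close> relative to rows \<open>i\<close> and \<open>j\<close>. It exists only when \<open>i\<close> and \<open>j\<close> are
  precisely the rows with a nonzero entry in column \<open>k\<close>; otherwise the value is left unspecified,
  so any claim about the value of a contraction requires this condition to be established.
\<close>

definition contraction :: "'a :: comm_semiring_1 mat \<Rightarrow> nat \<Rightarrow> nat \<Rightarrow> nat \<Rightarrow> 'a mat" where
  "contraction A k i j = (if contractible A k i j
     then mat_delete
       (mat (dim_row A) (dim_col A) (\<lambda>(p, q).
          if p = i then A $$ (j, k) * A $$ (i, q) + A $$ (i, k) * A $$ (j, q)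
          else A $$ (p, q))) j k
     else undefined)"

text \<open>With 0-based indices, the exceptional diagonal entry \<open>k\<^sub>2\<^sub>2 = 3\<close> sits at position (1, 1).\<close>

definition K_mat :: "nat \<Rightarrow> int mat" where
  "K_mat n = mat n n (\<lambda>(i, j).
     if i = j then (if i = 1 then 3 else 1)
     else if i = Suc j then 1
     else if j = Suc i then 2
     else 0)"

primrec K_contr :: "nat \<Rightarrow> nat \<Rightarrow> int mat" where
  "K_contr n 0 = K_mat n"
| "K_contr n (Suc r) = contraction (K_contr n r) 0 0 1"

end

theory Submission
  imports Defs
begin

text \<open>
  Contraction preserves the permanent: expanding along column \<open>k\<close>, whose only nonzero entries are
  in rows \<open>i\<close> and \<open>j\<close>, gives \<open>a\<^sub>i\<^sub>k per A(i|k) + a\<^sub>j\<^sub>k per A(j|k)\<close>, and linearity in the combined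
  row splits the permanent of the contraction into the same two terms. After \<open>r \<ge> 1\<close> contractions,
  \<open>K\<^sub>n\<close> keeps its tridiagonal shape except that the first row is \<open>(j\<^sub>r\<^sub>+\<^sub>1, 2 j\<^sub>r, 0, \<dots>)\<close>: contracting
  \<open>(a, b, 0, \<dots>)\<close> with the next row \<open>(1, 1, 2, 0, \<dots>)\<close> produces \<open>(a + b, 2a, 0, \<dots>)\<close>, which is
  the Jacobsthal-Lucas recurrence.
\<close>

section \<open>Column expansion, row linearity and row permutation of permanents\<close>

lemma permanent_carrier:
  assumes "A \<in> carrier_mat n n"
  shows "permanent A = (\<Sum>p | p permutes {0..<n}. \<Prod>i = 0..<n. A $$ (i, p i))"
  using assms by (simp add: permanent_def)

text \<open>Once the factor of row \<open>i\<close> is split off, the other rows are the values of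
  \<open>insert_index i\<close>, on which the inserted permutation is \<open>q\<close> with its
  values shifted past \<open>j\<close>.\<close>

lemma prod_permutation_insert:
  fixes A :: "'a :: comm_semiring_1 mat"
  assumes A: "A \<in> carrier_mat (Suc n) (Suc n)"
    and i: "i < Suc n" and j: "j < Suc n" and q: "q permutes {0..<n}"
  shows "(\<Prod>r = 0..<Suc n. A $$ (r, permutation_insert i j q r)) =
    A $$ (i, j) * (\<Prod>r = 0..<n. mat_delete A i j $$ (r, q r))"
proof -
  let ?p = "permutation_insert i j q"
  have "(\<Prod>r = 0..<Suc n. A $$ (r, ?p r)) = A $$ (i, j) * (\<Prod>r \<in> {0..<Suc n} - {i}. A $$ (r, ?p r))"
    using i prod.remove[of "{0..<Suc n}" i "\<lambda>r. A $$ (r, ?p r)"] by simp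
  also have "(\<Prod>r \<in> {0..<Suc n} - {i}. A $$ (r, ?p r)) =
      (\<Prod>r \<in> insert_index i ` {0..<n}. A $$ (r, ?p r))"
    by (simp only: insert_index_image[OF i])
  also have "\<dots> = (\<Prod>r = 0..<n. A $$ (insert_index i r, ?p (insert_index i r)))"
    by (simp add: prod.reindex[OF insert_index_inj_on])
  also have "\<dots> = (\<Prod>r = 0..<n. mat_delete A i j $$ (r, q r))"
  proof (rule prod.cong[OF refl])
    fix r assume r: "r \<in> {0..<n}"
    with q have "q r < n" by (auto dest: permutes_in_image)
    moreover have "?p (insert_index i r) = insert_index j (q r)"
      by (simp add: permutation_insert_expand insert_index_def)
    ultimately show "A $$ (insert_index i r, ?p (insert_index i r)) = mat_delete A i j $$ (r, q r)"
      using mat_delete_index[OF A i j] r by simp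
  qed
  finally show ?thesis .
qed

text \<open>Permutations are sorted by the row \<open>i\<close> that they send to \<open>k\<close>;
  each class is parametrised by the permutations for the minor through
  \<open>permutation_insert i k\<close>.\<close>

lemma permanent_laplace_column:
  fixes A :: "'a :: comm_semiring_1 mat"
  assumes A: "A \<in> carrier_mat (Suc n) (Suc n)" and k: "k < Suc n"
  shows "permanent A = (\<Sum>i<Suc n. A $$ (i, k) * permanent (mat_delete A i k))"
proof -
  let ?N = "{0..<Suc n}"
  let ?h = "\<lambda>p. \<Prod>r\<in>?N. A $$ (r, p r)"
  have kN: "k \<in> ?N" using k by simp
  have "permanent A = sum ?h (\<Union>i\<in>?N. {p. p permutes ?N \<and> p i = k})"
    unfolding permanent_carrier[OF A] permutation_split_ran[OF kN] ..
  also have "\<dots> = (\<Sum>i\<in>?N. sum ?h {p. p permutes ?N \<and> p i = k})"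
    using permutation_disjoint_dom[OF _ _ kN] finite_permutations[of ?N]
    by (intro sum.UNION_disjoint) auto
  also have "\<dots> = (\<Sum>i\<in>?N. A $$ (i, k) * permanent (mat_delete A i k))"
  proof (rule sum.cong[OF refl])
    fix i assume "i \<in> ?N"
    hence i: "i < Suc n" by simp
    have "sum ?h {p. p permutes ?N \<and> p i = k} =
        (\<Sum>q | q permutes {0..<n}. ?h (permutation_insert i k q))"
      unfolding permutation_fix[OF i k]
      by (simp add: sum.reindex[OF permutation_insert_inj_on[OF i k]])
    also have "\<dots> = (\<Sum>q | q permutes {0..<n}.
        A $$ (i, k) * (\<Prod>r = 0..<n. mat_delete A i k $$ (r, q r)))"
      using prod_permutation_insert[OF A i k] by (intro sum.cong) auto
    also have "\<dots> = A $$ (i, k) * permanent (mat_delete A i k)"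
      using permanent_carrier[of "mat_delete A i k" n] mat_delete_carrier[OF A]
      by (simp add: sum_distrib_left)
    finally show "sum ?h {p. p permutes ?N \<and> p i = k} = A $$ (i, k) * permanent (mat_delete A i k)" .
  qed
  finally show ?thesis by (simp only: atLeast0LessThan)
qed

lemma permanent_unit_column:
  fixes A :: "'a :: comm_semiring_1 mat"
  assumes A: "A \<in> carrier_mat (Suc n) (Suc n)" and i: "i < Suc n" and k: "k < Suc n"
    and col: "\<And>p. p < Suc n \<Longrightarrow> A $$ (p, k) = (if p = i then 1 else 0)"
  shows "permanent A = permanent (mat_delete A i k)"
proof -
  have "permanent A = (\<Sum>p<Suc n. if p = i then permanent (mat_delete A p k) else 0)"
    unfolding permanent_laplace_column[OF A k] by (intro sum.cong) (auto simp: col)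
  also have "\<dots> = permanent (mat_delete A i k)"
    using i by (simp add: sum.delta del: sum.lessThan_Suc)
  finally show ?thesis .
qed

text \<open>Every product in the sum has exactly one factor from row \<open>i\<close>.\<close>

lemma permanent_row_linear:
  fixes c d :: "'a :: comm_semiring_1"
  assumes i: "i < n"
  shows "permanent (mat n n (\<lambda>(p, q). if p = i then c * f q + d * g q else h p q)) =
    c * permanent (mat n n (\<lambda>(p, q). if p = i then f q else h p q)) +
    d * permanent (mat n n (\<lambda>(p, q). if p = i then g q else h p q))"
proof -
  have split: "permanent (mat n n (\<lambda>(p, q). if p = i then u q else h p q)) =
      (\<Sum>\<sigma> | \<sigma> permutes {0..<n}. u (\<sigma> i) * (\<Prod>p \<in> {0..<n} - {i}. h p (\<sigma> p)))" for u
  proof -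
    have "(\<Prod>p = 0..<n. mat n n (\<lambda>(p, q). if p = i then u q else h p q) $$ (p, \<sigma> p)) =
        u (\<sigma> i) * (\<Prod>p \<in> {0..<n} - {i}. h p (\<sigma> p))" if \<sigma>: "\<sigma> permutes {0..<n}" for \<sigma>
    proof -
      have lt: "\<sigma> p < n" if "p < n" for p
        using permutes_in_image[OF \<sigma>, of p] that by simp
      have "(\<Prod>p = 0..<n. mat n n (\<lambda>(p, q). if p = i then u q else h p q) $$ (p, \<sigma> p)) =
          (\<Prod>p = 0..<n. if p = i then u (\<sigma> p) else h p (\<sigma> p))"
        by (intro prod.cong) (auto simp: lt)
      also have "\<dots> = u (\<sigma> i) * (\<Prod>p \<in> {0..<n} - {i}. if p = i then u (\<sigma> p) else h p (\<sigma> p))"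
        using i by (subst prod.remove[of _ i]) auto
      finally show ?thesis by simp
    qed
    thus ?thesis
      by (subst permanent_carrier[of _ n]) auto
  qed
  show ?thesis
    unfolding split by (simp add: sum_distrib_left sum.distrib distrib_right mult.assoc)
qed

text \<open>Substituting \<open>\<sigma> \<circ> \<pi>\<close> for \<open>\<sigma>\<close> makes
  each product a reindexing by \<open>\<pi>\<close> of a product for \<open>A\<close>.\<close>

lemma permanent_permute_rows:
  fixes A :: "'a :: comm_semiring_1 mat"
  assumes A: "A \<in> carrier_mat n n" and \<pi>: "\<pi> permutes {0..<n}"
  shows "permanent (mat n n (\<lambda>(p, q). A $$ (\<pi> p, q))) = permanent A"
proof -
  have "permanent (mat n n (\<lambda>(p, q). A $$ (\<pi> p, q))) =
      (\<Sum>\<sigma> | \<sigma> permutes {0..<n}. \<Prod>p = 0..<n. A $$ (\<pi> p, \<sigma> p))"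
    by (subst permanent_carrier[of _ n]) (auto intro!: sum.cong prod.cong dest: permutes_in_image)
  also have "\<dots> = (\<Sum>\<sigma> | \<sigma> permutes {0..<n}. \<Prod>p = 0..<n. A $$ (\<pi> p, (\<sigma> \<circ> \<pi>) p))"
    by (rule sum_permutations_compose_right[OF \<pi>])
  also have "\<dots> = (\<Sum>\<sigma> | \<sigma> permutes {0..<n}. \<Prod>p = 0..<n. A $$ (p, \<sigma> p))"
    using prod.permute[OF \<pi>, of "\<lambda>p. A $$ (p, \<sigma> p)" for \<sigma>] by (simp add: o_def)
  finally show ?thesis by (simp add: permanent_carrier[OF A])
qed

section \<open>Invariance of the permanent under contraction\<close>

theorem permanent_contraction:
  fixes A :: "'a :: comm_semiring_1 mat"
  assumes A: "A \<in> carrier_mat n n" and contr: "contractible A k i j"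
  shows "permanent (contraction A k i j) = permanent A"
proof -
  have ij: "i \<noteq> j" and nz: "{p. p < n \<and> A $$ (p, k) \<noteq> 0} = {i, j}" and k: "k < n"
    using A contr by (auto simp: contractible_def)
  have i: "i < n" and j: "j < n" using nz by blast+
  obtain m where n: "n = Suc m" using k by (cases n) auto
  note A' = A[unfolded n] and k' = k[unfolded n]
  let ?a = "A $$ (i, k)" and ?b = "A $$ (j, k)"
  txt \<open>Replacing column \<open>k\<close> by a unit vector realises the minors \<open>A(j|k)\<close> and \<open>A(i|k)\<close> as
    permanents of \<open>n \<times> n\<close> matrices, where linearity in row \<open>i\<close> and the swap of rows \<open>i\<close>, \<open>j\<close>
    involve no index shifts.\<close>
  define f :: "nat \<Rightarrow> nat \<Rightarrow> 'a" where "f r q = (if q = k then 0 else A $$ (r, q))" for r q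
  define e :: "nat \<Rightarrow> nat \<Rightarrow> 'a" where
    "e p q = (if q = k then (if p = j then 1 else 0) else A $$ (p, q))" for p q
  define E where "E u = mat n n (\<lambda>(p, q). if p = i then u q else e p q)" for u
  \<comment> \<open>Swapping rows \<open>i\<close> and \<open>j\<close> of \<open>E (f j)\<close>
    moves the 1 in column \<open>k\<close> to row \<open>i\<close> and leaves row \<open>j\<close>
    of \<open>A\<close>, with column \<open>k\<close> zeroed, in row \<open>j\<close>. Deleting row
    \<open>i\<close> and column \<open>k\<close> then gives the minor of \<open>A\<close>.\<close>
  define S where "S = mat n n (\<lambda>(p, q). E (f j) $$ (transpose i j p, q))"
  have "permanent A = (\<Sum>p<n. A $$ (p, k) * permanent (mat_delete A p k))"
    using permanent_laplace_column[OF A' k'] by (simp only: n)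
  also have "\<dots> = (\<Sum>p\<in>{i, j}. A $$ (p, k) * permanent (mat_delete A p k))"
  proof (rule sum.mono_neutral_right)
    show "\<forall>p\<in>{..<n} - {i, j}. A $$ (p, k) * permanent (mat_delete A p k) = 0"
    proof
      fix p assume "p \<in> {..<n} - {i, j}"
      hence "A $$ (p, k) = 0" using nz by blast
      thus "A $$ (p, k) * permanent (mat_delete A p k) = 0" by simp
    qed
  qed (use i j in auto)
  also have "\<dots> = ?a * permanent (mat_delete A i k) + ?b * permanent (mat_delete A j k)"
    using ij by simp
  finally have perA: "permanent A = \<dots>" .
  have perE: "permanent (E u) = permanent (mat_delete (E u) j k)" if "u k = 0" for u
    using that ij n i j k by (intro permanent_unit_column[of _ m]) (auto simp: E_def e_def)
  \<comment> \<open>Zeroing column \<open>k\<close> in the combined row is harmless, since that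
    column is deleted, and it makes \<open>perE\<close> applicable.\<close>
  have c: "contraction A k i j = mat_delete (E (\<lambda>q. ?b * f i q + ?a * f j q)) j k"
    using contr A ij n
    by (auto simp: contraction_def mat_delete_def E_def e_def f_def intro!: eq_matI)
  have del_j: "mat_delete (E (f i)) j k = mat_delete A j k"
    using A n by (auto simp: mat_delete_def E_def e_def f_def intro!: eq_matI)
  have del_i: "mat_delete S i k = mat_delete A i k"
    using A n ij i j
    by (auto simp: mat_delete_def S_def E_def e_def f_def transpose_def intro!: eq_matI)
  have swap: "permanent S = permanent (E (f j))"
    unfolding S_def using i j
    by (intro permanent_permute_rows permutes_swap_id) (auto simp: E_def)
  have perS: "permanent S = permanent (mat_delete S i k)"
    using ij n i j k
    by (intro permanent_unit_column[of _ m]) (auto simp: S_def E_def e_def f_def transpose_def)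
  have "permanent (contraction A k i j) = permanent (E (\<lambda>q. ?b * f i q + ?a * f j q))"
    unfolding c by (rule perE[symmetric]) (simp add: f_def)
  also have "\<dots> = ?b * permanent (E (f i)) + ?a * permanent (E (f j))"
    unfolding E_def by (rule permanent_row_linear[OF i])
  also have "permanent (E (f i)) = permanent (mat_delete A j k)"
    using perE[of "f i"] del_j by (simp add: f_def)
  also have "permanent (E (f j)) = permanent (mat_delete A i k)"
    using swap perS del_i by simp
  finally show ?thesis by (simp add: perA add.commute)
qed

lemma permanent_1:
  fixes A :: "'a :: comm_semiring_1 mat"
  assumes "A \<in> carrier_mat (Suc 0) (Suc 0)"
  shows "permanent A = A $$ (0, 0)"
  by (simp add: permanent_carrier[OF assms])

lemma permanent_2:
  fixes A :: "'a :: comm_semiring_1 mat"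
  assumes A: "A \<in> carrier_mat 2 2"
  shows "permanent A = A $$ (0, 0) * A $$ (1, 1) + A $$ (0, 1) * A $$ (1, 0)"
proof -
  have A': "A \<in> carrier_mat (Suc (Suc 0)) (Suc (Suc 0))"
    using A by (simp add: numeral_2_eq_2)
  have "permanent (mat_delete A i 0) = mat_delete A i 0 $$ (0, 0)" for i
    using mat_delete_carrier[OF A'] by (intro permanent_1) simp
  thus ?thesis
    using A' by (simp add: permanent_laplace_column[OF A', of 0] mat_delete_def mult.commute)
qed

section \<open>Contractions of the tridiagonal matrices\<close>

definition tridiag :: "nat \<Rightarrow> int \<Rightarrow> int \<Rightarrow> int mat" where
  "tridiag m a b = mat m m (\<lambda>(i, j).
     if i = 0 then (if j = 0 then a else if j = 1 then b else 0)
     else if i = j \<or> i = Suc j then 1 else if j = Suc i then 2 else 0)"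

lemma contractible_tridiag:
  assumes "m \<ge> 2" "a \<noteq> 0"
  shows "contractible (tridiag m a b) 0 0 1"
  using assms by (auto simp: contractible_def tridiag_def split: if_splits)

lemma contraction_tridiag:
  assumes "m \<ge> 1" "a \<noteq> 0"
  shows "contraction (tridiag (Suc m) a b) 0 0 1 = tridiag m (a + b) (2 * a)"
  using contractible_tridiag[of "Suc m" a b] assms
  by (auto simp: contraction_def mat_delete_def tridiag_def intro!: eq_matI)

lemma contractible_K_mat:
  assumes "n \<ge> 2"
  shows "contractible (K_mat n) 0 0 1"
  using assms by (auto simp: contractible_def K_mat_def split: if_splits)

text \<open>The rows (1, 2, 0, ...) and (1, 3, 2, 0, ...) add up to (2, 5, 2, 0, ...), whose first
  entry is dropped. This absorbs the exceptional 3 and starts the recurrence with 5 = j_2 and 2 = 2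
  j_1.\<close>

lemma contraction_K_mat:
  assumes "n \<ge> 2"
  shows "contraction (K_mat n) 0 0 1 = tridiag (n - 1) 5 2"
  using contractible_K_mat[OF assms] assms
  by (auto simp: contraction_def mat_delete_def K_mat_def tridiag_def intro!: eq_matI)

text \<open>Keeps the top left entry nonzero, so that every further contraction is defined.\<close>

lemma jacobsthal_lucas_pos: "jacobsthal_lucas m > 0"
  by (induction m rule: jacobsthal_lucas.induct) auto

lemma K_contr_Suc:
  assumes "Suc r < n"
  shows "K_contr n (Suc r) =
    tridiag (n - Suc r) (jacobsthal_lucas (Suc (Suc r))) (2 * jacobsthal_lucas (Suc r))"
  using assms
proof (induction r)
  case 0
  thus ?case using contraction_K_mat[of n] by simp
next
  case (Suc r)
  define m where "m = n - Suc (Suc r)"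
  have m: "n - Suc r = Suc m" "m \<ge> 1" using Suc.prems by (auto simp: m_def)
  have "jacobsthal_lucas (Suc (Suc r)) \<noteq> 0"
    using jacobsthal_lucas_pos[of "Suc (Suc r)"] by linarith
  from contraction_tridiag[OF m(2) this] Suc m(1) show ?case
    by (simp add: m_def)
qed

lemma K_contr_carrier_contractible:
  assumes "Suc r < n"
  shows "K_contr n r \<in> carrier_mat (n - r) (n - r)" and "contractible (K_contr n r) 0 0 1"
proof -
  have "K_contr n r \<in> carrier_mat (n - r) (n - r) \<and> contractible (K_contr n r) 0 0 1"
  proof (cases r)
    case 0
    thus ?thesis using assms contractible_K_mat[of n] by (simp add: K_mat_def)
  next
    case (Suc s)
    have "jacobsthal_lucas (Suc (Suc s)) \<noteq> 0"
      using jacobsthal_lucas_pos[of "Suc (Suc s)"] by linarith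
    with contractible_tridiag[of "n - r"] assms K_contr_Suc[of s n] show ?thesis
      by (simp add: Suc tridiag_def)
  qed
  thus "K_contr n r \<in> carrier_mat (n - r) (n - r)" and "contractible (K_contr n r) 0 0 1"
    by blast+
qed

lemma permanent_K_contr:
  assumes "r < n"
  shows "permanent (K_contr n r) = permanent (K_mat n)"
  using assms
proof (induction r)
  case (Suc r)
  thus ?case
    using permanent_contraction[OF K_contr_carrier_contractible[of r n]] by simp
qed simp

theorem theorem2:
  fixes n :: nat
  assumes "n \<ge> 2"
  shows "permanent (K_mat n) = permanent (K_contr n (n - 2)) \<and>
    permanent (K_contr n (n - 2)) = jacobsthal_lucas n"
proof
  show "permanent (K_mat n) = permanent (K_contr n (n - 2))"
    using assms permanent_K_contr[of "n - 2" n] by simp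
  show "permanent (K_contr n (n - 2)) = jacobsthal_lucas n"
  proof (cases "n = 2")
    case True
    \<comment> \<open>Nothing is contracted here, so the entry 3 is still present: 1 * 3 + 2 * 1 =
      5.\<close>
    have "permanent (K_mat 2) = 5"
      by (subst permanent_2) (auto simp: K_mat_def)
    with True show ?thesis by (simp add: numeral_2_eq_2)
  next
    case False
    with assms obtain r where n: "n = Suc (Suc (Suc r))"
      by (metis One_nat_def Suc_1 not0_implies_Suc not_less_eq_eq le0)
    \<comment> \<open>The last matrix has rows (a, b) and (1, 1) with a = j_{n-1} and b = 2 j_{n-2},
      so a + b is j_n by the recurrence.\<close>
    have "permanent (tridiag 2 a b) = a + b" for a b
      by (subst permanent_2) (auto simp: tridiag_def)
    thus ?thesis using K_contr_Suc[of r n] by (simp add: n numeral_2_eq_2)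
  qed
qed

end
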